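(* There is an absolute constant $C>0$ such that for each integer $N\ge 2$ there exists a function $f:\mathbb{R}^2\to\{0,1,-1\}$ which is zero outside the square $[0,N]\times[0,N]$, is constant and equal to $1$ or $-1$ on each of the squares $(i,j)+[0,1)^2$, $0\le i,j<N$ (with $i,j$ integers), and is such that on any straight line segment $I\subset\mathbb{R}^2$ we have $$\left|\int_I f\right|\ \le\ C\sqrt{N\log N}.$$
   Context: The integral $\int_I f$ is taken with respect to arc length (one-dimensional Lebesgue measure) along the segment $I$. The constant $C$ is absolute: it does not depend on $N$ or on $I$. *)

theory Defs
  imports "HOL-Analysis.Analysis"
begin

(* On a nondegenerate segment, s ranges over arc length from a to b; if a = b the domain is {0}. *)
definition segment_param :: "'a::real_normed_vector \<Rightarrow> 'a \<Rightarrow> real \<Rightarrow> 'a" where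
  "segment_param a b s = a + s *\<^sub>R sgn (b - a)"

definition segment_integrable :: "'a::real_normed_vector \<Rightarrow> 'a \<Rightarrow> ('a \<Rightarrow> real) \<Rightarrow> bool" where
  "segment_integrable a b f \<longleftrightarrow> set_integrable lebesgue {0..dist a b} (\<lambda>s. f (segment_param a b s))"

(* Like the Bochner integral, this is 0 by convention when f is not integrable along the
   segment, so integrability has to be asserted separately. *)
definition segment_integral :: "'a::real_normed_vector \<Rightarrow> 'a \<Rightarrow> ('a \<Rightarrow> real) \<Rightarrow> real" where
  "segment_integral a b f = (LINT s:{0..dist a b}|lebesgue. f (segment_param a b s))"

lemma segment_param_image:
  "segment_param a b ` {0..dist a b} = closed_segment a b"
proof (cases "a = b")
  case True
  then show ?thesis by (simp add: segment_param_def)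
next
  case False
  have "segment_param a b ` {0..dist a b} = (\<lambda>u. a + u *\<^sub>R (b - a)) ` {0..1}"
  proof (intro equalityI image_subsetI)
    fix s assume "s \<in> {0..dist a b}"
    then show "segment_param a b s \<in> (\<lambda>u. a + u *\<^sub>R (b - a)) ` {0..1}"
      using False
      by (intro image_eqI[where x = "s / dist a b"])
         (auto simp: segment_param_def sgn_div_norm dist_norm norm_minus_commute divide_simps)
  next
    fix u :: real assume "u \<in> {0..1}"
    then show "a + u *\<^sub>R (b - a) \<in> segment_param a b ` {0..dist a b}"
      using False
      by (intro image_eqI[where x = "u * dist a b"])
         (auto simp: segment_param_def sgn_div_norm dist_norm norm_minus_commute mult_left_le_one_le)
  qed
  then show ?thesis
    by (simp add: closed_segment_image_interval algebra_simps)
qed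

end

theory Submission
  imports Defs
begin

text \<open>
  Colour the unit cells by independent random signs. A line that makes an angle of at most
  45 degrees with the \<open>x\<close>-axis is the graph of \<open>x \<mapsto> m * x + b\<close> with \<open>\<bar>m\<bar> \<le> 1\<close>. Over an interval of
  the \<open>x\<close>-axis, the integral of the colouring along it is \<open>\<Sum>ij. c ij * g ij\<close>, where \<open>g ij\<close> is the length
  of the part of that interval over which the line runs inside the cell \<open>ij\<close>. Each \<open>g ij\<close> lies in
  \<open>[0, 1]\<close> and they add up to at most \<open>N\<close>, so their squares also add up to at most \<open>N\<close>
  (\<open>sum_graph_integral_cell_squares_le\<close>). A random signed sum therefore has Gaussian tails with
  variance at most \<open>N\<close>, and a union bound controls \<open>N ^ O(1)\<close> such sums at once by a constant times
  \<open>sqrt (N * ln N)\<close>. Here the union bound takes the derandomised form \<open>exists_balancing_signs\<close>: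
  the signs are fixed one at a time so that an exponential potential does not grow.

  It remains to replace all segments by polynomially many. The net consists of the lines whose
  slope and intercept are multiples of \<open>1 / N ^ 3\<close>, over intervals with integer end points. Moving
  the end points costs at most 2 (\<open>graph_integral_interval_le\<close>). Moving the line is delicate,
  because the colouring jumps at the grid lines and a line can stay close to one of them. There are
  two cases.

  \<^item> If \<open>\<bar>m\<bar> * N \<ge> 1\<close>, the line is close to horizontal grid lines only over a short set, and rounding
    the slope and the intercept changes the integral by a bounded amount (\<open>graph_integral_steep\<close>).

  \<^item> If \<open>\<bar>m\<bar> * N \<le> 1\<close>, the line crosses at most one horizontal grid line over the square, and its
    integral is exactly the sum of two integrals along horizontal rows, whose lines belong to the net
    (\<open>graph_integral_flat\<close>).

  Lines closer to the vertical become graphs after the two coordinates are exchanged; so the signs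
  are balanced for the colouring and for its transpose together.
\<close>

section \<open>Balancing many weight vectors by one choice of signs\<close>

text \<open>
  The Taylor series compare term by term, since \<open>fact k * 2 ^ k \<le> fact (2 * k)\<close>. This is the
  subgaussian bound for the moment generating function of a random sign.
\<close>

lemma cosh_le_exp_half_square: "cosh x \<le> exp (x\<^sup>2 / 2)" for x :: real
proof -
  define f where "f n = (if even n then (x\<^sup>2 / 2) ^ (n div 2) / fact (n div 2) else 0)" for n
  have le: "(if even n then x ^ n /\<^sub>R fact n else 0) \<le> f n" for n
  proof (cases "even n")
    case True
    then obtain k where k: "n = 2 * k" by (elim evenE)
    have "(fact k :: real) * 2 ^ k \<le> fact (2 * k)"
    proof (induction k)
      case (Suc k)
      have "(fact (Suc k) :: real) * 2 ^ Suc k = 2 * (real k + 1) * (fact k * 2 ^ k)"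
        by (simp add: algebra_simps)
      also have "\<dots> \<le> 2 * (real k + 1) * fact (2 * k)"
        using Suc by (intro mult_left_mono) auto
      also have "\<dots> = 1 * (2 * (real k + 1) * fact (2 * k))"
        by (simp only: mult_1)
      also have "\<dots> \<le> (2 * real k + 1) * (2 * (real k + 1) * fact (2 * k))"
        by (intro mult_right_mono) auto
      also have "\<dots> = fact (2 * Suc k)"
        by (simp add: algebra_simps)
      finally show ?case .
    qed simp
    then have "x ^ (2 * k) / fact (2 * k) \<le> x ^ (2 * k) / (fact k * 2 ^ k)"
      by (intro divide_left_mono) (simp_all add: power_mult[of x 2 k])
    also have "\<dots> = (x\<^sup>2 / 2) ^ k / fact k"
      unfolding power_mult[of x 2 k] power_divide by simp
    finally show ?thesis
      by (simp add: f_def k field_simps)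
  qed (simp add: f_def)
  have "(\<lambda>k. f (2 * k)) sums exp (x\<^sup>2 / 2)"
    using exp_converges[of "x\<^sup>2 / 2"] by (simp add: f_def field_simps)
  moreover have "f n = 0" if "n \<notin> range (\<lambda>k. 2 * k)" for n
  proof -
    have "odd n" using that by (metis evenE rangeI)
    then show ?thesis by (simp add: f_def)
  qed
  ultimately have "f sums exp (x\<^sup>2 / 2)"
    by (subst (asm) sums_mono_reindex) (auto simp: strict_mono_def)
  then show ?thesis
    by (rule sums_le[OF le cosh_converges])
qed

definition signs :: "('a \<Rightarrow> real) set" where
  "signs = {c. range c \<subseteq> {1, -1}}"

lemma signs_cases: "c \<in> signs \<Longrightarrow> c a = 1 \<or> c a = -1"
  unfolding signs_def by blast

lemma signs_update: "c \<in> signs \<Longrightarrow> e \<in> {1, -1} \<Longrightarrow> c(a := e) \<in> signs"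
  unfolding signs_def by (simp add: image_subset_iff)

lemma signs_comp: "c \<in> signs \<Longrightarrow> c \<circ> g \<in> signs"
  unfolding signs_def by (simp add: image_subset_iff)

text \<open>
  The method of conditional expectations. For random signs the expectation of the left-hand side is
  a sum of products of values of \<open>cosh\<close>, which is at most the right-hand side. The coefficients
  \<open>K\<close> make the induction work: when the sign of one more point is fixed, the factor
  \<open>exp ((w t a)\<^sup>2 / 2)\<close> that pays for it is moved into them.
\<close>

lemma exists_signs_sum_cosh_le:
  fixes w :: "'t \<Rightarrow> 'a \<Rightarrow> real" and K :: "'t \<Rightarrow> real"
  assumes "finite A" "finite T" "\<And>t. t \<in> T \<Longrightarrow> K t \<ge> 0"
  shows "\<exists>c\<in>signs.
    (\<Sum>t\<in>T. K t * cosh (\<Sum>a\<in>A. c a * w t a)) \<le> (\<Sum>t\<in>T. K t * exp ((\<Sum>a\<in>A. (w t a)\<^sup>2) / 2))"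
  using assms(1,3)
proof (induction A arbitrary: K rule: finite_induct)
  case empty
  show ?case by (intro bexI[of _ "\<lambda>_. 1"]) (simp_all add: signs_def)
next
  case (insert a A)
  define K' where "K' t = K t * exp ((w t a)\<^sup>2 / 2)" for t
  have "K' t \<ge> 0" if "t \<in> T" for t
    using insert.prems that by (simp add: K'_def)
  from insert.IH[of K', OF this] obtain c where c: "c \<in> signs"
    and le: "(\<Sum>t\<in>T. K' t * cosh (\<Sum>a\<in>A. c a * w t a)) \<le> (\<Sum>t\<in>T. K' t * exp ((\<Sum>a\<in>A. (w t a)\<^sup>2) / 2))"
    by blast
  define S where "S t = (\<Sum>a\<in>A. c a * w t a)" for t
  define P where "P e = (\<Sum>t\<in>T. K t * cosh (e * w t a + S t))" for e :: real
  have "P 1 + P (-1) = (\<Sum>t\<in>T. 2 * (K t * (cosh (w t a) * cosh (S t))))"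
    unfolding P_def sum.distrib[symmetric]
    by (intro sum.cong refl) (simp add: cosh_add cosh_diff algebra_simps)
  also have "\<dots> \<le> (\<Sum>t\<in>T. 2 * (K' t * cosh (S t)))"
    unfolding K'_def mult.assoc
    using insert.prems by (intro sum_mono mult_left_mono mult_right_mono cosh_le_exp_half_square) auto
  finally have "P 1 + P (-1) \<le> 2 * (\<Sum>t\<in>T. K' t * cosh (S t))"
    by (simp add: sum_distrib_left)
  \<comment> \<open>The average of the two choices is small enough, so one of them is.\<close>
  then have "P 1 \<le> (\<Sum>t\<in>T. K' t * cosh (S t)) \<or> P (-1) \<le> (\<Sum>t\<in>T. K' t * cosh (S t))"
    by linarith
  then obtain e where e: "e \<in> {1, -1}" "P e \<le> (\<Sum>t\<in>T. K' t * cosh (S t))"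
    by blast
  have S': "(\<Sum>b\<in>insert a A. (c(a := e)) b * w t b) = e * w t a + S t" for t
  proof -
    have "(\<Sum>b\<in>A. (c(a := e)) b * w t b) = S t"
      unfolding S_def using insert.hyps by (intro sum.cong) auto
    then show ?thesis
      using insert.hyps by simp
  qed
  have "P e \<le> (\<Sum>t\<in>T. K' t * exp ((\<Sum>a\<in>A. (w t a)\<^sup>2) / 2))"
    using e(2) le by (simp add: S_def)
  also have "\<dots> = (\<Sum>t\<in>T. K t * exp ((\<Sum>b\<in>insert a A. (w t b)\<^sup>2) / 2))"
    using insert.hyps by (simp add: K'_def exp_add add_divide_distrib mult.assoc)
  finally have "(\<Sum>t\<in>T. K t * cosh (\<Sum>b\<in>insert a A. (c(a := e)) b * w t b))
      \<le> (\<Sum>t\<in>T. K t * exp ((\<Sum>b\<in>insert a A. (w t b)\<^sup>2) / 2))"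
    unfolding S' P_def .
  then show ?case
    by (rule bexI[OF _ signs_update[OF c e(1)]])
qed

text \<open>
  The Chernoff bound together with the union bound: no single term of the potential can exceed the
  whole sum, and \<open>exp \<bar>X\<bar> \<le> 2 * cosh X\<close> turns a bound on the potential into one on \<open>\<bar>X\<bar>\<close>.
\<close>

lemma exists_balancing_signs:
  fixes w :: "'t \<Rightarrow> 'a \<Rightarrow> real"
  assumes "finite A" "finite T" "S > 0"
    and w: "\<And>t. t \<in> T \<Longrightarrow> (\<Sum>a\<in>A. (w t a)\<^sup>2) \<le> S"
    and R: "2 * real (card T) \<le> R" "R > 1"
  shows "\<exists>c\<in>signs.
    (\<forall>t\<in>T. \<bar>\<Sum>a\<in>A. c a * w t a\<bar> \<le> sqrt (2 * S * ln R))"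
proof -
  \<comment> \<open>The scaling that minimises \<open>ln R / r + r * S / 2\<close>.\<close>
  define r where "r = sqrt (2 * ln R / S)"
  have r: "r > 0" "r\<^sup>2 = 2 * ln R / S"
    using assms(3) R(2) by (auto simp: r_def)
  obtain c where c: "c \<in> signs"
    and le: "(\<Sum>t\<in>T. 1 * cosh (\<Sum>a\<in>A. c a * (r * w t a)))
      \<le> (\<Sum>t\<in>T. 1 * exp ((\<Sum>a\<in>A. (r * w t a)\<^sup>2) / 2))"
    using exists_signs_sum_cosh_le[OF assms(1,2), of "\<lambda>_. 1" "\<lambda>t a. r * w t a"] by auto
  have "\<bar>\<Sum>a\<in>A. c a * w t a\<bar> \<le> sqrt (2 * S * ln R)" if t: "t \<in> T" for t
  proof -
    define X where "X = (\<Sum>a\<in>A. c a * w t a)"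
    have "exp \<bar>r * X\<bar> \<le> 2 * cosh (r * X)"
      unfolding cosh_field_def by (cases "r * X \<ge> 0") auto
    also have "cosh (r * X) = cosh (\<Sum>a\<in>A. c a * (r * w t a))"
      by (simp add: X_def sum_distrib_left mult_ac)
    also have "\<dots> \<le> (\<Sum>t\<in>T. cosh (\<Sum>a\<in>A. c a * (r * w t a)))"
      using t assms(2) by (intro member_le_sum) auto
    also have "\<dots> \<le> (\<Sum>t\<in>T. exp ((\<Sum>a\<in>A. (r * w t a)\<^sup>2) / 2))"
      using le by simp
    also have "\<dots> \<le> (\<Sum>t\<in>T. R)"
    proof (intro sum_mono)
      fix t assume "t \<in> T"
      have "(\<Sum>a\<in>A. (r * w t a)\<^sup>2) / 2 = r\<^sup>2 / 2 * (\<Sum>a\<in>A. (w t a)\<^sup>2)"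
        by (simp add: power_mult_distrib sum_distrib_left sum_divide_distrib)
      also have "\<dots> \<le> r\<^sup>2 / 2 * S"
        using w[OF \<open>t \<in> T\<close>] by (intro mult_left_mono) auto
      also have "\<dots> = ln R"
        using r(2) assms(3) by simp
      finally show "exp ((\<Sum>a\<in>A. (r * w t a)\<^sup>2) / 2) \<le> R"
        using R(2) by (simp flip: ln_ge_iff)
    qed
    finally have "exp \<bar>r * X\<bar> \<le> (2 * real (card T)) * R"
      by simp
    also have "\<dots> \<le> R * R"
      using R by (intro mult_right_mono) auto
    also have "\<dots> = exp (2 * ln R)"
      using R(2) by (simp add: exp_double power2_eq_square)
    finally have "r * \<bar>X\<bar> \<le> 2 * ln R"
      using r(1) by (simp add: abs_mult)
    also have "2 * ln R = r * (r * S)"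
      using r(2) assms(3) by (simp add: power2_eq_square field_simps)
    finally have "\<bar>X\<bar> \<le> r * S"
      using r(1) by simp
    also have "\<dots> = sqrt (2 * S * ln R)"
      using assms(3) R(2) by (simp add: r_def real_sqrt_divide real_sqrt_mult real_div_sqrt field_simps)
    finally show ?thesis
      unfolding X_def .
  qed
  with c show ?thesis by blast
qed

section \<open>Colourings of the unit cells\<close>

text \<open>
  The cells are half-open, so each point of \<open>{0..<N} \<times> {0..<N}\<close> lies in exactly one of them. A
  colouring vanishes on the right and the top edge of the closed square.
\<close>

definition cell :: "nat \<times> nat \<Rightarrow> (real \<times> real) set" where
  "cell ij = {real (fst ij)..<real (fst ij) + 1} \<times> {real (snd ij)..<real (snd ij) + 1}"

definition cells :: "nat \<Rightarrow> (nat \<times> nat) set" where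
  "cells N = {..<N} \<times> {..<N}"

definition coloring :: "nat \<Rightarrow> (nat \<times> nat \<Rightarrow> real) \<Rightarrow> real \<times> real \<Rightarrow> real" where
  "coloring N c p = (\<Sum>ij\<in>cells N. c ij * indicator (cell ij) p)"

lemma finite_cells [simp]: "finite (cells N)"
  by (simp add: cells_def)

lemma mem_cell_iff: "(x, y) \<in> cell ij \<longleftrightarrow> 0 \<le> x \<and> 0 \<le> y \<and> ij = (nat \<lfloor>x\<rfloor>, nat \<lfloor>y\<rfloor>)"
proof -
  have "real i \<le> z \<and> z < real i + 1 \<longleftrightarrow> 0 \<le> z \<and> i = nat \<lfloor>z\<rfloor>" for i z
  proof
    assume *: "real i \<le> z \<and> z < real i + 1"
    then have "\<lfloor>z\<rfloor> = int i" by (intro floor_unique) auto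
    with * show "0 \<le> z \<and> i = nat \<lfloor>z\<rfloor>" by auto
  next
    assume "0 \<le> z \<and> i = nat \<lfloor>z\<rfloor>"
    then have "real i = of_int \<lfloor>z\<rfloor>" by simp
    then show "real i \<le> z \<and> z < real i + 1" by linarith
  qed
  then show ?thesis
    by (cases ij) (auto simp: cell_def)
qed

lemma coloring_eq:
  "coloring N c (x, y) = (if 0 \<le> x \<and> x < N \<and> 0 \<le> y \<and> y < N then c (nat \<lfloor>x\<rfloor>, nat \<lfloor>y\<rfloor>) else 0)"
proof (cases "0 \<le> x \<and> 0 \<le> y")
  case True
  have "coloring N c (x, y)
      = (\<Sum>ij\<in>cells N. if (nat \<lfloor>x\<rfloor>, nat \<lfloor>y\<rfloor>) = ij then c ij else 0)"
    unfolding coloring_def using True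
    by (intro sum.cong refl) (auto simp: indicator_def mem_cell_iff)
  also have "\<dots> = (if (nat \<lfloor>x\<rfloor>, nat \<lfloor>y\<rfloor>) \<in> cells N then c (nat \<lfloor>x\<rfloor>, nat \<lfloor>y\<rfloor>) else 0)"
    by (rule sum.delta'[OF finite_cells])
  also have "(nat \<lfloor>x\<rfloor>, nat \<lfloor>y\<rfloor>) \<in> cells N \<longleftrightarrow> x < N \<and> y < N"
    using True by (auto simp: cells_def nat_less_iff floor_less_iff)
  finally show ?thesis
    using True by auto
next
  case False
  then have "coloring N c (x, y) = 0"
    unfolding coloring_def by (intro sum.neutral) (auto simp: indicator_def mem_cell_iff)
  with False show ?thesis by auto
qed

text \<open>
  A colouring changes along a vertical line only at integer heights. Hence two lines have the same
  colour over \<open>x\<close> unless a horizontal grid line separates them there.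
\<close>

lemma coloring_floor: "coloring N c (x, of_int \<lfloor>y\<rfloor>) = coloring N c (x, y)"
proof -
  have "of_int \<lfloor>y\<rfloor> < real N \<longleftrightarrow> y < real N"
    using floor_less_iff[of y "int N"] by auto
  then show ?thesis
    by (simp add: coloring_eq)
qed

lemma coloring_swap: "coloring N (c \<circ> prod.swap) p = coloring N c (prod.swap p)"
  by (cases p) (auto simp: coloring_eq)

lemma abs_coloring_le_1:
  assumes "c \<in> signs"
  shows "\<bar>coloring N c p\<bar> \<le> 1"
proof -
  have "\<bar>c ij\<bar> = 1" for ij
    using signs_cases[OF assms, of ij] by auto
  then show ?thesis
    by (cases p) (simp add: coloring_eq)
qed

lemma borel_cell [measurable]: "cell ij \<in> sets borel"
  unfolding cell_def by (simp add: borel_prod[symmetric])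

lemma borel_measurable_coloring [measurable]: "coloring N c \<in> borel_measurable borel"
  unfolding coloring_def by measurable

section \<open>Integrals over graphs of affine functions\<close>

text \<open>
  The integral along the graph is taken with respect to \<open>x\<close>; for arc length it would have to be
  multiplied by \<open>sqrt (1 + m\<^sup>2)\<close>, which is at most \<open>sqrt 2\<close> for the slopes that matter.
\<close>

definition graph_integral :: "real set \<Rightarrow> real \<Rightarrow> real \<Rightarrow> (real \<times> real \<Rightarrow> real) \<Rightarrow> real" where
  "graph_integral J m b f = (LINT x|lborel. indicator J x * f (x, m * x + b))"

lemma integrable_graph:
  assumes [measurable]: "J \<in> sets borel"
  shows "integrable lborel (\<lambda>x. indicator J x * coloring N c (x, m * x + b))"
proof (rule Bochner_Integration.integrable_bound)
  define B where "B = (\<Sum>ij\<in>cells N. \<bar>c ij\<bar>)"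
  show "integrable lborel (\<lambda>x. B * indicator {0..real N} x :: real)"
    by simp
  show "AE x in lborel. norm (indicator J x * coloring N c (x, m * x + b))
      \<le> norm (B * indicator {0..real N} x)"
  proof (intro AE_I2)
    fix x
    have B: "B \<ge> 0" unfolding B_def by (simp add: sum_nonneg)
    have "\<bar>coloring N c p\<bar> \<le> B" for p
      unfolding coloring_def B_def
      by (rule order_trans[OF sum_abs], intro sum_mono) (auto simp: indicator_def)
    from this[of "(x, m * x + b)"] B
    show "norm (indicator J x * coloring N c (x, m * x + b)) \<le> norm (B * indicator {0..real N} x)"
      by (cases "x \<in> {0..real N}") (auto simp: indicator_def coloring_eq)
  qed
qed (use assms in measurable)

lemma abs_integral_diff_le_measure:
  fixes g h :: "real \<Rightarrow> real"
  assumes "integrable lborel g" "integrable lborel h"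
    and D: "D \<in> sets borel" "emeasure lborel D < \<infinity>"
    and le: "\<And>x. \<bar>g x - h x\<bar> \<le> K * indicator D x"
  shows "\<bar>(LINT x|lborel. g x) - (LINT x|lborel. h x)\<bar> \<le> K * measure lborel D"
proof -
  have "\<bar>(LINT x|lborel. g x) - (LINT x|lborel. h x)\<bar> = \<bar>LINT x|lborel. g x - h x\<bar>"
    using assms by simp
  also have "\<dots> \<le> (LINT x|lborel. K * indicator D x)"
    using assms by (intro integral_abs_bound_integral) auto
  finally show ?thesis
    using D by simp
qed


text \<open>
  Only finitely many intercepts are relevant for slopes in \<open>[-1, 1]\<close>, which makes the net finite.
\<close>

lemma graph_integral_outside:
  assumes "\<bar>m\<bar> \<le> 1" "\<bar>b\<bar> \<ge> 2 * real N"
  shows "graph_integral J m b (coloring N c) = 0"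
proof -
  have "coloring N c (x, m * x + b) = 0" for x
  proof (cases "0 \<le> x \<and> x < N")
    case True
    have "\<bar>m * x\<bar> \<le> 1 * x"
      unfolding abs_mult using assms(1) True by (intro mult_mono) auto
    with assms(2) True show ?thesis
      unfolding coloring_eq by auto
  qed (auto simp: coloring_eq)
  then show ?thesis
    by (simp add: graph_integral_def)
qed

lemma integrable_graph_cell:
  assumes [measurable]: "J \<in> sets borel"
  shows "integrable lborel (\<lambda>x. indicator J x * indicator (cell ij) (x, m * x + b) :: real)"
proof (rule Bochner_Integration.integrable_bound)
  show "integrable lborel (indicator {real (fst ij)..real (fst ij) + 1} :: real \<Rightarrow> real)"
    by simp
  show "AE x in lborel. norm (indicator J x * indicator (cell ij) (x, m * x + b) :: real)
      \<le> norm (indicator {real (fst ij)..real (fst ij) + 1} x :: real)"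
    by (intro AE_I2) (auto simp: indicator_def cell_def)
qed measurable

lemma graph_integral_coloring:
  assumes "J \<in> sets borel"
  shows "graph_integral J m b (coloring N c)
    = (\<Sum>ij\<in>cells N. c ij * graph_integral J m b (indicator (cell ij)))"
proof -
  have "graph_integral J m b (coloring N c)
      = (LINT x|lborel. (\<Sum>ij\<in>cells N. c ij * (indicator J x * indicator (cell ij) (x, m * x + b))))"
    unfolding graph_integral_def coloring_def by (simp only: sum_distrib_left mult.left_commute)
  also have "\<dots> = (\<Sum>ij\<in>cells N. c ij * graph_integral J m b (indicator (cell ij)))"
    unfolding graph_integral_def using integrable_graph_cell[OF assms]
    by (subst Bochner_Integration.integral_sum) auto
  finally show ?thesis .
qed

text \<open>
  Each summand is the length of a subset of \<open>[i, i + 1]\<close>, hence at most 1, and squaring only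
  decreases it. The summands add up to at most \<open>N\<close>, because the cells are disjoint and the whole
  square projects onto \<open>[0, N)\<close>.
\<close>

lemma sum_graph_integral_cell_squares_le:
  assumes J: "J \<in> sets borel"
  shows "(\<Sum>ij\<in>cells N. (graph_integral J m b (indicator (cell ij)))\<^sup>2) \<le> N"
proof -
  define g where "g ij = graph_integral J m b (indicator (cell ij))" for ij
  have g: "0 \<le> g ij" "g ij \<le> 1" for ij
  proof -
    show "0 \<le> g ij"
      unfolding g_def graph_integral_def by simp
    have "g ij \<le> (LINT x|lborel. indicator {real (fst ij)..real (fst ij) + 1} x)"
      unfolding g_def graph_integral_def
    proof (rule integral_mono[OF integrable_graph_cell[OF J]])
      show "integrable lborel (indicator {real (fst ij)..real (fst ij) + 1} :: real \<Rightarrow> real)"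
        by simp
    qed (auto simp: indicator_def cell_def)
    then show "g ij \<le> 1" by simp
  qed
  have "(\<Sum>ij\<in>cells N. (g ij)\<^sup>2) \<le> (\<Sum>ij\<in>cells N. 1 * g ij)"
    unfolding power2_eq_square using g by (intro sum_mono mult_right_mono) auto
  also have "\<dots> = graph_integral J m b (coloring N (\<lambda>_. 1))"
    using J by (simp add: graph_integral_coloring g_def)
  also have "\<dots> \<le> (LINT x|lborel. indicator {0..real N} x)"
    unfolding graph_integral_def
  proof (rule integral_mono[OF integrable_graph[OF J]])
    show "integrable lborel (indicator {0..real N} :: real \<Rightarrow> real)"
      by simp
  qed (auto simp: indicator_def coloring_eq)
  finally show ?thesis
    by (simp add: g_def)
qed

section \<open>A colouring balanced on a polynomial net of lines\<close>

text \<open>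
  The net, counted together with its transpose and with the factor 2 of the two tails, has at most
  \<open>N ^ 18\<close> members, so balancing gives the bound \<open>sqrt (2 * N * ln (N ^ 18)) = 6 * sqrt (N * ln N)\<close>.
  Intercepts outside the finite range contribute nothing.
\<close>

lemma exists_coloring_small_on_net:
  assumes N: "N \<ge> 2"
  shows "\<exists>c\<in>signs.
    (\<forall>c'\<in>{c, c \<circ> prod.swap}. \<forall>p q::int. \<forall>i\<le>N. \<forall>j\<le>N. \<bar>p\<bar> \<le> int N ^ 3 \<longrightarrow>
      \<bar>graph_integral {real i..real j} (p / real N ^ 3) (q / real N ^ 3) (coloring N c')\<bar>
        \<le> 6 * sqrt (N * ln N))"
proof -
  define M where "M = int N ^ 3"
  define R where "R = 3 * int N * M"
  define g where "g p q i j = (\<lambda>ij. graph_integral {real i..real j} (p / real N ^ 3) (q / real N ^ 3)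
      (indicator (cell ij)))" for p q :: int and i j :: nat
  define T where "T = {-M..M} \<times> {-R..R} \<times> {..N} \<times> {..N} \<times> (UNIV :: bool set)"
  \<comment> \<open>The flag \<open>s\<close> transposes the weights, which has the same effect as transposing the colouring.\<close>
  define w where "w = (\<lambda>(p, q, i, j, s) ij. g p q i j (if s then prod.swap ij else ij))"
  have swap_cells: "bij_betw prod.swap (cells N) (cells N)"
    by (intro bij_betwI[where g = prod.swap]) (auto simp: cells_def)
  have MR: "M \<ge> 0" "R \<ge> 0"
    by (auto simp: M_def R_def)
  have card: "2 * real (card T) \<le> real N ^ 18"
  proof -
    have n: "real N \<ge> 2" using N by simp
    have pow: "2 ^ k \<le> real N ^ k" for k
      using n by (intro power_mono) auto
    have "card T = nat (2 * M + 1) * (nat (2 * R + 1) * ((N + 1) * ((N + 1) * 2)))"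
      using MR by (simp add: T_def card_cartesian_product)
    then have "2 * real (card T)
        = 4 * (2 * real N ^ 3 + 1) * (6 * real N ^ 4 + 1) * (real N + 1)\<^sup>2"
      using MR by (simp add: M_def R_def power2_eq_square eval_nat_numeral algebra_simps)
    also have "\<dots> \<le> real N ^ 2 * real N ^ 5 * real N ^ 7 * real N ^ 4"
    proof (intro mult_mono)
      show "4 \<le> real N ^ 2" using pow[of 2] by simp
      have "2 * real N ^ 3 + 1 \<le> 4 * real N ^ 3" using pow[of 3] by simp
      also have "\<dots> \<le> real N ^ 2 * real N ^ 3" using pow[of 2] by (intro mult_right_mono) auto
      finally show "2 * real N ^ 3 + 1 \<le> real N ^ 5" by (simp flip: power_add)
      have "6 * real N ^ 4 + 1 \<le> 8 * real N ^ 4" using pow[of 4] by simp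
      also have "\<dots> \<le> real N ^ 3 * real N ^ 4" using pow[of 3] by (intro mult_right_mono) auto
      finally show "6 * real N ^ 4 + 1 \<le> real N ^ 7" by (simp flip: power_add)
      have "real N + 1 \<le> 2 * real N" using n by simp
      also have "\<dots> \<le> real N * real N" using n by (intro mult_right_mono) auto
      finally have "(real N + 1)\<^sup>2 \<le> (real N * real N)\<^sup>2" by (intro power_mono) auto
      then show "(real N + 1)\<^sup>2 \<le> real N ^ 4" by (simp add: eval_nat_numeral algebra_simps)
    qed auto
    also have "\<dots> = real N ^ 18" by (simp flip: power_add)
    finally show ?thesis .
  qed
  have sq: "(\<Sum>ij\<in>cells N. (w t ij)\<^sup>2) \<le> N" for t
  proof -
    obtain p q i j s where t: "t = (p, q, i, j, s)" by (cases t)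
    have "(\<Sum>ij\<in>cells N. (w t ij)\<^sup>2) = (\<Sum>ij\<in>cells N. (g p q i j ij)\<^sup>2)"
      using sum.reindex_bij_betw[OF swap_cells, of "\<lambda>ij. (g p q i j ij)\<^sup>2"]
      by (cases s) (simp_all add: t w_def)
    then show ?thesis
      unfolding g_def using sum_graph_integral_cell_squares_le by simp
  qed
  have "finite T" "real N > 0" "real N ^ 18 > 1"
    using N by (simp_all add: T_def)
  from exists_balancing_signs[where w = w, OF finite_cells this(1,2) sq card this(3)]
  obtain c where c: "c \<in> signs"
    and le: "\<forall>t\<in>T. \<bar>\<Sum>ij\<in>cells N. c ij * w t ij\<bar> \<le> sqrt (2 * real N * ln (real N ^ 18))"
    by blast
  have sqrt: "sqrt (2 * real N * ln (real N ^ 18)) = 6 * sqrt (N * ln N)"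
  proof -
    have "2 * real N * ln (real N ^ 18) = 6\<^sup>2 * (N * ln N)"
      using N by (simp add: ln_realpow)
    then show ?thesis by (simp only: real_sqrt_mult real_sqrt_pow2_iff) simp
  qed
  have "\<bar>graph_integral {real i..real j} (p / real N ^ 3) (q / real N ^ 3) (coloring N c')\<bar>
      \<le> 6 * sqrt (N * ln N)"
    if c': "c' \<in> {c, c \<circ> prod.swap}" and ij: "i \<le> N" "j \<le> N" and p: "\<bar>p\<bar> \<le> M"
    for c' and p q :: int and i j
  proof (cases "\<bar>q\<bar> \<le> R")
    case True
    define s where "s \<longleftrightarrow> c' \<noteq> c"
    have "(p, q, i, j, s) \<in> T"
      using True ij p by (auto simp: T_def)
    moreover have "(\<Sum>ij\<in>cells N. c ij * w (p, q, i, j, s) ij) = (\<Sum>ij\<in>cells N. c' ij * g p q i j ij)"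
    proof (cases s)
      case True
      then have "c' = c \<circ> prod.swap" using c' by (auto simp: s_def)
      with True show ?thesis
        using sum.reindex_bij_betw[OF swap_cells, of "\<lambda>ij. c (prod.swap ij) * g p q i j ij"]
        by (simp add: w_def)
    qed (simp add: s_def w_def)
    moreover have "graph_integral {real i..real j} (p / real N ^ 3) (q / real N ^ 3) (coloring N c')
        = (\<Sum>ij\<in>cells N. c' ij * g p q i j ij)"
      unfolding g_def by (rule graph_integral_coloring) simp
    ultimately show ?thesis
      using le unfolding sqrt by fastforce
  next
    case False
    then have "real_of_int \<bar>q\<bar> \<ge> of_int R" by linarith
    then have "\<bar>q / real N ^ 3\<bar> \<ge> 3 * real N"
      using N by (simp add: R_def M_def field_simps)
    moreover have "real_of_int \<bar>p\<bar> \<le> of_int M" using p by linarith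
    then have "\<bar>p / real N ^ 3\<bar> \<le> 1"
      using N by (simp add: M_def field_simps)
    ultimately have "graph_integral {real i..real j} (p / real N ^ 3) (q / real N ^ 3) (coloring N c') = 0"
      by (intro graph_integral_outside) auto
    then show ?thesis using N by simp
  qed
  with c show ?thesis unfolding M_def by blast
qed

section \<open>From the net to all lines\<close>

text \<open>
  Rounding the end points of \<open>J \<inter> [0, N)\<close> outwards to integers keeps them in \<open>[0, N]\<close> and changes
  the integral by at most the length that is added, which is at most 2.
\<close>

lemma graph_integral_interval_le:
  assumes c: "c \<in> signs" and J: "is_interval J" "J \<in> sets borel"
    and B: "\<And>i j. i \<le> N \<Longrightarrow> j \<le> N \<Longrightarrow> \<bar>graph_integral {real i..real j} m b (coloring N c)\<bar> \<le> B"
  shows "\<bar>graph_integral J m b (coloring N c)\<bar> \<le> B + 2"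
proof -
  define J' where "J' = J \<inter> {0..<real N}"
  have eq: "graph_integral J m b (coloring N c) = graph_integral J' m b (coloring N c)"
    unfolding graph_integral_def J'_def
    by (intro Bochner_Integration.integral_cong refl) (auto simp: indicator_def coloring_eq)
  show ?thesis
  proof (cases "J' = {}")
    case True
    then have "graph_integral J' m b (coloring N c) = 0"
      by (simp add: graph_integral_def)
    with B[of 0 0] show ?thesis
      unfolding eq by auto
  next
    case False
    define \<alpha> \<beta> where "\<alpha> = Inf J'" and "\<beta> = Sup J'"
    have bdd: "bdd_below J'" "bdd_above J'"
      using bdd_belowI[of J' 0] bdd_aboveI[of J' "real N"] by (auto simp: J'_def)
    have mem: "\<alpha> \<le> x" "x \<le> \<beta>" if "x \<in> J'" for x
      using that bdd by (auto simp: \<alpha>_def \<beta>_def intro: cInf_lower cSup_upper)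
    have ab: "0 \<le> \<alpha>" "\<beta> \<le> real N"
      unfolding \<alpha>_def \<beta>_def using False by (auto simp: J'_def intro!: cInf_greatest cSup_least)
    have inner: "x \<in> J'" if x: "\<alpha> < x" "x < \<beta>" for x
    proof -
      obtain u where "u \<in> J'" "u < x"
        using x(1) cInf_lessD[OF False] unfolding \<alpha>_def by blast
      moreover obtain v where "v \<in> J'" "x < v"
        using x(2) less_cSupD[OF False] unfolding \<beta>_def by blast
      ultimately show ?thesis
        using J(1) unfolding J'_def is_interval_1 by auto
    qed
    have "\<alpha> \<le> \<beta>" using False mem by force
    define i j where "i = nat \<lfloor>\<alpha>\<rfloor>" and "j = nat \<lceil>\<beta>\<rceil>"
    have i: "real i \<le> \<alpha>" "\<alpha> \<le> real i + 1" and j: "\<beta> \<le> real j" "real j \<le> \<beta> + 1"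
      using ab \<open>\<alpha> \<le> \<beta>\<close> by (auto simp: i_def j_def)
    have "i \<le> N" "j \<le> N"
      using ab \<open>\<alpha> \<le> \<beta>\<close> by (auto simp: i_def j_def nat_le_iff ceiling_le_iff) linarith
    define D where "D = {real i..\<alpha>} \<union> {\<beta>..real j}"
    have Dfin: "emeasure lborel D < \<infinity>"
      unfolding D_def by (intro emeasure_bounded_finite) auto
    have "measure lborel D \<le> measure lborel {real i..\<alpha>} + measure lborel {\<beta>..real j}"
      unfolding D_def by (intro measure_Un_le) auto
    also have "\<dots> \<le> 2"
      using i j by simp
    finally have "measure lborel D \<le> 2" .
    have "\<bar>graph_integral J' m b (coloring N c) - graph_integral {real i..real j} m b (coloring N c)\<bar>
        \<le> 1 * measure lborel D"
      unfolding graph_integral_def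
    proof (rule abs_integral_diff_le_measure)
      fix x
      have "(x \<in> J' \<longleftrightarrow> x \<in> {real i..real j}) \<or> x \<in> D"
        using mem[of x] inner[of x] i j unfolding D_def by force
      then show "\<bar>indicator J' x * coloring N c (x, m * x + b)
          - indicator {real i..real j} x * coloring N c (x, m * x + b)\<bar> \<le> 1 * indicator D x"
        using abs_coloring_le_1[OF c, of N "(x, m * x + b)"] by (auto simp: indicator_def)
    qed (use J Dfin in \<open>auto simp: J'_def D_def intro!: integrable_graph\<close>)
    then show ?thesis
      using B[OF \<open>i \<le> N\<close> \<open>j \<le> N\<close>] \<open>measure lborel D \<le> 2\<close> unfolding eq by linarith
  qed
qed

lemma is_interval_affine_preimage:
  fixes m b :: real
  assumes "is_interval J" "is_interval I"
  shows "is_interval {x \<in> J. m * x + b \<in> I}"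
  unfolding is_interval_1
proof (intro ballI allI impI)
  fix u v x assume u: "u \<in> {x \<in> J. m * x + b \<in> I}" and v: "v \<in> {x \<in> J. m * x + b \<in> I}"
    and x: "u \<le> x \<and> x \<le> v"
  have "(m * u \<le> m * x \<and> m * x \<le> m * v) \<or> (m * v \<le> m * x \<and> m * x \<le> m * u)"
    using x by (cases "m \<ge> 0") (auto intro: mult_left_mono mult_left_mono_neg)
  then have "m * x + b \<in> I"
  proof
    assume "m * u \<le> m * x \<and> m * x \<le> m * v"
    then have "m * u + b \<le> m * x + b" "m * x + b \<le> m * v + b" by auto
    with u v show ?thesis using mem_is_interval_1_I[OF assms(2)] by blast
  next
    assume "m * v \<le> m * x \<and> m * x \<le> m * u"
    then have "m * v + b \<le> m * x + b" "m * x + b \<le> m * u + b" by auto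
    with u v show ?thesis using mem_is_interval_1_I[OF assms(2)] by blast
  qed
  moreover have "x \<in> J"
    using u v x mem_is_interval_1_I[OF assms(1)] by blast
  ultimately show "x \<in> {x \<in> J. m * x + b \<in> I}" by simp
qed

text \<open>
  Over \<open>[0, N)\<close> the line rises or falls by at most 1, so it stays in two adjacent rows \<open>k\<close> and
  \<open>k + 1\<close>. By monotonicity it is in each of them over an interval, and there it may be replaced by
  the lower edge of the row.
\<close>

lemma graph_integral_flat:
  assumes J: "is_interval J" "J \<in> sets borel" and m: "\<bar>m\<bar> * real N \<le> 1"
  obtains J1 J2 k where "is_interval J1" "J1 \<in> sets borel" "is_interval J2" "J2 \<in> sets borel"
    "graph_integral J m b (coloring N c)
      = graph_integral J1 0 (of_int k) (coloring N c) + graph_integral J2 0 (of_int (k + 1)) (coloring N c)"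
proof -
  define k where "k = \<lfloor>min b (b + m * real N)\<rfloor>"
  define J1 where "J1 = {x \<in> J. m * x + b \<in> {..<of_int (k + 1)}}"
  define J2 where "J2 = {x \<in> J. m * x + b \<in> {of_int (k + 1)..}}"
  have ivl: "is_interval J1" "is_interval J2"
    unfolding J1_def J2_def
    by (intro is_interval_affine_preimage J(1) is_interval_io is_interval_ci)+
  have J_alt: "J1 = J \<inter> {x. m * x + b < of_int (k + 1)}" "J2 = J \<inter> {x. of_int (k + 1) \<le> m * x + b}"
    unfolding J1_def J2_def by auto
  have meas: "J1 \<in> sets borel" "J2 \<in> sets borel"
    unfolding J_alt by (intro sets.Int J(2); measurable)+
  have pt: "indicator J x * coloring N c (x, m * x + b)
      = indicator J1 x * coloring N c (x, 0 * x + of_int k) + indicator J2 x * coloring N c (x, 0 * x + of_int (k + 1))" for x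
  proof (cases "x \<in> J \<and> 0 \<le> x \<and> x < real N")
    case True
    have *: "min b (b + m * real N) \<le> m * x + b \<and> m * x + b \<le> min b (b + m * real N) + 1"
    proof (cases "m \<ge> 0")
      case m0: True
      have "0 \<le> m * x" "m * x \<le> m * real N" "m * real N \<le> 1"
        using m m0 True by (auto intro: mult_left_mono)
      then show ?thesis by linarith
    next
      case m0: False
      have "m * x \<le> 0"
        using m0 True by (intro mult_nonpos_nonneg) auto
      moreover have "m * real N \<le> m * x"
        using m0 True by (intro mult_left_mono_neg) auto
      moreover have "m * real N \<ge> -1"
        using m m0 by simp
      ultimately show ?thesis by linarith
    qed
    then have "of_int k \<le> m * x + b" "m * x + b < of_int k + 2"
      unfolding k_def by linarith+
    then have floor: "\<lfloor>m * x + b\<rfloor> = (if m * x + b < of_int (k + 1) then k else k + 1)"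
      by (auto intro!: floor_unique)
    then show ?thesis
    proof (cases "m * x + b < of_int (k + 1)")
      case below: True
      then have "indicator J1 x = (1::real)" "indicator J2 x = (0::real)"
        using True by (simp_all add: J_alt)
      with below floor True coloring_floor[of N c x "m * x + b"] show ?thesis by simp
    next
      case above: False
      then have "indicator J1 x = (0::real)" "indicator J2 x = (1::real)"
        using True by (simp_all add: J_alt)
      with above floor True coloring_floor[of N c x "m * x + b"] show ?thesis by simp
    qed
  qed (auto simp: indicator_def J_alt coloring_eq)
  have "graph_integral J m b (coloring N c)
      = graph_integral J1 0 (of_int k) (coloring N c) + graph_integral J2 0 (of_int (k + 1)) (coloring N c)"
    unfolding graph_integral_def pt
    by (intro Bochner_Integration.integral_add integrable_graph meas)
  with ivl meas show ?thesis using that by blast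
qed

lemma emeasure_affine_strip:
  fixes m b u h :: real
  assumes "m \<noteq> 0" "h \<ge> 0"
  shows "emeasure lborel {x. u \<le> m * x + b \<and> m * x + b \<le> u + h} = ennreal (h / \<bar>m\<bar>)"
proof (cases "m > 0")
  case True
  then have "{x. u \<le> m * x + b \<and> m * x + b \<le> u + h} = {(u - b) / m..(u - b) / m + h / m}"
    by (auto simp: field_simps)
  with True assms show ?thesis by simp
next
  case False
  with assms(1) have m: "m < 0" by simp
  then have "{x. u \<le> m * x + b \<and> m * x + b \<le> u + h} = {(u - b) / m + h / m..(u - b) / m}"
    by (auto simp: field_simps)
  moreover have "h / m \<le> 0"
    using m assms(2) by (simp add: divide_nonneg_neg)
  ultimately show ?thesis using m by (simp add: divide_minus_right)
qed

text \<open>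
  The two lines can have different colours at \<open>x\<close> only if a horizontal grid line separates them
  there, and then the upper line is at most \<open>h\<close> above it. Each of the \<open>N + 1\<close> grid lines of the square
  excludes a set of length \<open>h / \<bar>m\<bar> \<le> N * h\<close>, on which the two integrands differ by at most 2.
\<close>

lemma graph_integral_steep:
  assumes c: "c \<in> signs" and J: "J \<in> sets borel"
    and N: "N > 0" and m: "\<bar>m\<bar> * real N \<ge> 1" and h: "h \<le> 1"
    and near: "\<And>x. 0 \<le> x \<Longrightarrow> x < real N \<Longrightarrow> m' * x + b' \<le> m * x + b \<and> m * x + b \<le> m' * x + b' + h"
  shows "\<bar>graph_integral J m b (coloring N c) - graph_integral J m' b' (coloring N c)\<bar>
    \<le> 2 * ((real N + 1) * real N * h)"
proof -
  define D where "D = (\<Union>k\<in>{..N}. {x. real k \<le> m * x + b \<and> m * x + b \<le> real k + h})"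
  have m0: "m \<noteq> 0" using m by auto
  have h0: "h \<ge> 0" using near[of 0] N by auto
  have Dm: "{x. real k \<le> m * x + b \<and> m * x + b \<le> real k + h} \<in> sets borel" for k
    by measurable
  have "emeasure lborel D \<le> (\<Sum>k\<le>N. emeasure lborel {x. real k \<le> m * x + b \<and> m * x + b \<le> real k + h})"
    unfolding D_def using Dm by (intro emeasure_subadditive_finite) auto
  also have "\<dots> = (\<Sum>k\<le>N. ennreal (h / \<bar>m\<bar>))"
    using m0 h0 by (intro sum.cong refl emeasure_affine_strip)
  also have "\<dots> = ennreal ((real N + 1) * (h / \<bar>m\<bar>))"
    using h0 by (subst sum_ennreal) (simp_all add: add.commute)
  also have "\<dots> \<le> ennreal ((real N + 1) * real N * h)"
  proof (intro ennreal_leI)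
    have "h * 1 \<le> h * (\<bar>m\<bar> * real N)"
      using h0 m by (intro mult_left_mono)
    then have "h / \<bar>m\<bar> \<le> real N * h"
      using m0 by (simp add: field_simps)
    then have "(real N + 1) * (h / \<bar>m\<bar>) \<le> (real N + 1) * (real N * h)"
      by (intro mult_left_mono) auto
    then show "(real N + 1) * (h / \<bar>m\<bar>) \<le> (real N + 1) * real N * h"
      by (simp add: mult.assoc)
  qed
  finally have Dle: "emeasure lborel D \<le> ennreal ((real N + 1) * real N * h)" .
  then have Dfin: "emeasure lborel D < \<infinity>"
    using ennreal_less_top order_le_less_trans by (metis infinity_ennreal_def)
  have Dmeas: "measure lborel D \<le> (real N + 1) * real N * h"
    unfolding measure_def using Dle h0 by (simp add: enn2real_leI)
  have "\<bar>graph_integral J m b (coloring N c) - graph_integral J m' b' (coloring N c)\<bar>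
      \<le> 2 * measure lborel D"
    unfolding graph_integral_def
  proof (rule abs_integral_diff_le_measure)
    fix x
    let ?y = "m * x + b" and ?y' = "m' * x + b'"
    have "coloring N c (x, ?y) = coloring N c (x, ?y')" if "x \<notin> D"
    proof (cases "0 \<le> x \<and> x < real N \<and> \<lfloor>?y\<rfloor> \<noteq> \<lfloor>?y'\<rfloor>")
      case False
      then consider "x < 0 \<or> real N \<le> x" | "\<lfloor>?y\<rfloor> = \<lfloor>?y'\<rfloor>"
        by linarith
      then show ?thesis
      proof cases
        case 1
        then show ?thesis by (auto simp: coloring_eq)
      next
        case 2
        then show ?thesis using coloring_floor[of N c x] by metis
      qed
    next
      case True
      then have y: "?y' \<le> ?y" "?y \<le> ?y' + h" using near by auto
      then have "?y' < of_int \<lfloor>?y\<rfloor>"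
        using True floor_mono[OF y(1)] by linarith
      \<comment> \<open>The separating grid line \<open>\<lfloor>?y\<rfloor>\<close> must miss the square; as \<open>h \<le> 1\<close>, both lines do so, too.\<close>
      have "\<lfloor>?y\<rfloor> < 0 \<or> \<lfloor>?y\<rfloor> > int N"
      proof (rule ccontr)
        assume "\<not> ?thesis"
        then have *: "nat \<lfloor>?y\<rfloor> \<le> N" "real (nat \<lfloor>?y\<rfloor>) = of_int \<lfloor>?y\<rfloor>" by auto
        have "real (nat \<lfloor>?y\<rfloor>) \<le> ?y \<and> ?y \<le> real (nat \<lfloor>?y\<rfloor>) + h"
          using y \<open>?y' < of_int \<lfloor>?y\<rfloor>\<close> unfolding *(2) by linarith
        with *(1) that show False unfolding D_def by blast
      qed
      then have "(?y < 0 \<and> ?y' < 0) \<or> (real N \<le> ?y \<and> real N \<le> ?y')"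
      proof
        assume "\<lfloor>?y\<rfloor> < 0"
        then show ?thesis using y by (simp add: floor_less_iff)
      next
        assume "\<lfloor>?y\<rfloor> > int N"
        then have "real N + 1 \<le> ?y" by linarith
        then show ?thesis using y h by simp
      qed
      then show ?thesis by (auto simp: coloring_eq)
    qed
    then show "\<bar>indicator J x * coloring N c (x, ?y) - indicator J x * coloring N c (x, ?y')\<bar>
        \<le> 2 * indicator D x"
      using abs_coloring_le_1[OF c, of N "(x, ?y)"] abs_coloring_le_1[OF c, of N "(x, ?y')"]
      by (cases "x \<in> D") (auto simp: indicator_def)
  qed (use J Dfin Dm in \<open>auto simp: D_def intro!: integrable_graph sets.finite_UN\<close>)
  with Dmeas show ?thesis by linarith
qed

text \<open>
  A flat line costs two rows, each at most \<open>B + 2\<close>. For a steep line, rounding down to multiples of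
  \<open>1 / N ^ 3\<close> lowers the line by at most \<open>h = (N + 1) / N ^ 3\<close>, which costs
  \<open>2 * (N + 1) * N * h = 2 * ((N + 1) / N)\<^sup>2 \<le> 9 / 2\<close>, in addition to \<open>B + 2\<close>.
\<close>

lemma graph_integral_le_of_net:
  assumes c: "c \<in> signs" and N: "N \<ge> 2" and J: "is_interval J" "J \<in> sets borel"
    and m: "\<bar>m\<bar> \<le> 1"
    and net: "\<And>(p::int) (q::int) i j. \<bar>p\<bar> \<le> int N ^ 3 \<Longrightarrow> i \<le> N \<Longrightarrow> j \<le> N \<Longrightarrow>
      \<bar>graph_integral {real i..real j} (p / real N ^ 3) (q / real N ^ 3) (coloring N c)\<bar> \<le> B"
  shows "\<bar>graph_integral J m b (coloring N c)\<bar> \<le> 2 * B + 7"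
proof -
  define M where "M = real N ^ 3"
  have M: "M > 0" using N by (simp add: M_def)
  have net': "\<bar>graph_integral J' (p / M) (q / M) (coloring N c)\<bar> \<le> B + 2"
    if "\<bar>p\<bar> \<le> int N ^ 3" "is_interval J'" "J' \<in> sets borel" for p q :: int and J'
    unfolding M_def by (rule graph_integral_interval_le[OF c that(2,3) net[OF that(1)]])
  have B: "B \<ge> 0"
    using net[of 0 0 0 0] by (simp add: order_trans[OF abs_ge_zero])
  show ?thesis
  proof (cases "\<bar>m\<bar> * real N \<le> 1")
    case True
    obtain J1 J2 k where k: "is_interval J1" "J1 \<in> sets borel" "is_interval J2" "J2 \<in> sets borel"
      "graph_integral J m b (coloring N c)
        = graph_integral J1 0 (of_int k) (coloring N c) + graph_integral J2 0 (of_int (k + 1)) (coloring N c)"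
      using graph_integral_flat[OF J True] .
    have row: "\<bar>graph_integral J' 0 (of_int l) (coloring N c)\<bar> \<le> B + 2"
      if "is_interval J'" "J' \<in> sets borel" for J' l
      \<comment> \<open>The horizontal lines at integer height belong to the net.\<close>
      using net'[of 0 J' "l * int N ^ 3"] that M by (simp add: M_def)
    show ?thesis
      using row[OF k(1,2), of k] row[OF k(3,4), of "k + 1"] unfolding k(5) by linarith
  next
    case False
    define p q where "p = \<lfloor>m * M\<rfloor>" and "q = \<lfloor>b * M\<rfloor>"
    have "\<bar>m * M\<bar> \<le> M"
      using m M by (simp add: abs_mult)
    then have "of_int (- (int N ^ 3)) \<le> m * M" "m * M \<le> of_int (int N ^ 3)"
      unfolding M_def by (auto simp: abs_le_iff)
    then have p: "\<bar>p\<bar> \<le> int N ^ 3"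
      unfolding p_def using floor_mono[of "m * M" "of_int (int N ^ 3)"] le_floor_iff[of "- (int N ^ 3)" "m * M"]
      by (simp only: floor_of_int) linarith
    have pm: "p / M \<le> m" "m \<le> p / M + 1 / M" and qb: "q / M \<le> b" "b \<le> q / M + 1 / M"
      using M unfolding p_def q_def by (auto simp: field_simps) linarith+
    define h where "h = (real N + 1) / M"
    have n: "real N \<ge> 2" using N by simp
    have "real N + 1 \<le> 2 * real N"
      using n by simp
    also have "\<dots> \<le> real N * real N"
      using n by (intro mult_right_mono) auto
    also have "\<dots> \<le> real N * (real N * real N)"
      using n by (intro mult_left_mono) auto
    finally have h: "h \<le> 1"
      using M unfolding h_def M_def by (simp add: eval_nat_numeral)
    have near: "p / M * x + q / M \<le> m * x + b \<and> m * x + b \<le> p / M * x + q / M + h"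
      if x: "0 \<le> x" "x < real N" for x
    proof -
      have "p / M * x \<le> m * x" "m * x \<le> (p / M + 1 / M) * x"
        by (intro mult_right_mono pm x(1))+
      moreover have "1 / M * x \<le> 1 / M * real N"
        using x M by (intro mult_left_mono) auto
      ultimately show ?thesis
        using qb unfolding h_def by (simp add: algebra_simps add_divide_distrib)
    qed
    have "\<bar>graph_integral J m b (coloring N c) - graph_integral J (p / M) (q / M) (coloring N c)\<bar>
        \<le> 2 * ((real N + 1) * real N * h)"
      using N False h near by (intro graph_integral_steep c J(2)) auto
    also have "(real N + 1) * real N * h = ((real N + 1) / real N)\<^sup>2"
      using n unfolding h_def M_def by (simp add: field_simps eval_nat_numeral)
    also have "\<dots> \<le> (3 / 2)\<^sup>2"
      using n by (intro power_mono) (auto simp: field_simps)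
    finally have "\<bar>graph_integral J m b (coloring N c) - graph_integral J (p / M) (q / M) (coloring N c)\<bar>
        \<le> 9 / 2"
      by (simp add: power2_eq_square)
    with net'[OF p J, of q] B show ?thesis by linarith
  qed
qed

section \<open>Segments\<close>

lemma borel_measurable_segment_coloring:
  "(\<lambda>s. indicator {0..d} s * coloring N c (a + s *\<^sub>R u)) \<in> borel_measurable lborel"
  by measurable

lemma segment_integrable_coloring:
  assumes c: "c \<in> signs"
  shows "segment_integrable a b (coloring N c)"
proof -
  have "integrable lborel (\<lambda>s. indicator {0..dist a b} s * coloring N c (a + s *\<^sub>R sgn (b - a)))"
  proof (rule Bochner_Integration.integrable_bound)
    show "integrable lborel (indicator {0..dist a b} :: real \<Rightarrow> real)"
      by simp
    show "AE s in lborel. norm (indicator {0..dist a b} s * coloring N c (a + s *\<^sub>R sgn (b - a)))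
        \<le> norm (indicator {0..dist a b} s :: real)"
      using abs_coloring_le_1[OF c] by (intro AE_I2) (auto simp: indicator_def)
  qed (rule borel_measurable_segment_coloring)
  then show ?thesis
    unfolding segment_integrable_def set_integrable_def segment_param_def
    using integrable_completion[OF borel_measurable_segment_coloring] by simp
qed

lemma segment_integral_coloring:
  "segment_integral a b (coloring N c)
    = (LINT s|lborel. indicator {0..dist a b} s * coloring N c (a + s *\<^sub>R sgn (b - a)))"
  unfolding segment_integral_def set_lebesgue_integral_def segment_param_def
  using integral_completion[OF borel_measurable_segment_coloring] by simp

text \<open>
  The first coordinate is an affine function of arc length with slope \<open>fst u\<close>; substituting it
  parametrises the segment as a graph.
\<close>

lemma segment_integral_eq_graph_integral:
  fixes a b :: "real \<times> real"
  defines "u \<equiv> sgn (b - a)"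
  assumes "fst u \<noteq> 0"
  obtains J k where "is_interval J" "J \<in> sets borel"
    "\<bar>fst u\<bar> * segment_integral a b (coloring N c) = graph_integral J (snd u / fst u) k (coloring N c)"
proof -
  define m where "m = 1 / fst u"
  define k where "k = - (m * fst a)"
  define J where "J = {x \<in> UNIV. m * x + k \<in> {0..dist a b}}"
  define k' where "k' = snd a - snd u / fst u * fst a"
  have "is_interval J"
    unfolding J_def by (intro is_interval_affine_preimage) auto
  moreover have "J \<in> sets borel"
    unfolding J_def by simp
  moreover have "graph_integral J (snd u / fst u) k' (coloring N c)
      = \<bar>fst u\<bar> * segment_integral a b (coloring N c)"
  proof -
    have "m * (fst a + fst u * s) + k = s" for s
      using assms(2) by (simp add: m_def k_def field_simps)
    then have J: "indicator J (fst a + fst u * s) = (indicator {0..dist a b} s :: real)" for s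
      by (simp add: J_def indicator_def)
    have pt: "(fst a + fst u * s, snd u / fst u * (fst a + fst u * s) + k') = a + s *\<^sub>R u" for s
      using assms(2) by (simp add: prod_eq_iff k'_def field_simps)
    show ?thesis
      unfolding graph_integral_def segment_integral_coloring
      using lborel_integral_real_affine[OF assms(2), where t = "fst a"
          and f = "\<lambda>x. indicator J x * coloring N c (x, snd u / fst u * x + k')"]
      unfolding J pt u_def[symmetric] by simp
  qed
  ultimately show ?thesis using that by metis
qed

lemma segment_integral_swap:
  fixes a b :: "real \<times> real"
  shows "segment_integral (prod.swap a) (prod.swap b) f = segment_integral a b (f \<circ> prod.swap)"
proof -
  have "norm (prod.swap v) = norm v" for v :: "real \<times> real"
    by (cases v) (simp add: norm_Pair add.commute)
  moreover have diff: "prod.swap b - prod.swap a = prod.swap (b - a)"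
    by (simp add: prod_eq_iff)
  ultimately have norm: "norm (prod.swap b - prod.swap a) = norm (b - a)"
    by simp
  then have "dist (prod.swap a) (prod.swap b) = dist a b"
    unfolding dist_norm norm_minus_commute[of "prod.swap a"] norm_minus_commute[of a] .
  moreover have "segment_param (prod.swap a) (prod.swap b) s = prod.swap (segment_param a b s)" for s
    unfolding segment_param_def sgn_div_norm norm by (simp add: prod_eq_iff)
  ultimately show ?thesis
    by (simp add: segment_integral_def)
qed

text \<open>
  If the direction \<open>u\<close> makes an angle of at most 45 degrees with the horizontal, then \<open>\<bar>fst u\<bar> \<ge> 1 / sqrt 2 \<ge> 1 / 2\<close>,
  so passing from \<open>x\<close> to arc length costs at most a factor 2.
\<close>

lemma segment_integral_le_of_graphs:
  fixes a b :: "real \<times> real"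
  assumes dir: "\<bar>snd (b - a)\<bar> \<le> \<bar>fst (b - a)\<bar>" and K: "K \<ge> 0"
    and graph: "\<And>J m k. is_interval J \<Longrightarrow> J \<in> sets borel \<Longrightarrow> \<bar>m\<bar> \<le> 1 \<Longrightarrow>
      \<bar>graph_integral J m k (coloring N c)\<bar> \<le> K"
  shows "\<bar>segment_integral a b (coloring N c)\<bar> \<le> 2 * K"
proof (cases "a = b")
  case True
  have "segment_integral a b (coloring N c) = (LINT s|lborel. indicator {0::real} s * coloring N c a)"
    unfolding segment_integral_coloring True by simp
  also have "\<dots> = measure lborel {0::real} * coloring N c a"
    by simp
  also have "measure lborel {0::real} = 0"
    by (simp add: measure_def)
  finally show ?thesis using K by simp
next
  case False
  define u where "u = sgn (b - a)"
  have u: "\<bar>snd u\<bar> \<le> \<bar>fst u\<bar>" "(fst u)\<^sup>2 + (snd u)\<^sup>2 = 1"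
  proof -
    show "\<bar>snd u\<bar> \<le> \<bar>fst u\<bar>"
      using dir unfolding u_def sgn_div_norm by (simp add: abs_mult mult_left_mono)
    have "norm u = 1" using False by (simp add: u_def norm_sgn)
    then show "(fst u)\<^sup>2 + (snd u)\<^sup>2 = 1" by (simp add: norm_prod_def)
  qed
  have "(snd u)\<^sup>2 \<le> (fst u)\<^sup>2"
    using u(1) by (simp add: abs_le_square_iff)
  with u(2) have "(1 / 2)\<^sup>2 \<le> (fst u)\<^sup>2"
    by (simp add: power2_eq_square)
  then have half: "1 / 2 \<le> \<bar>fst u\<bar>"
    using abs_le_square_iff[of "1 / 2" "fst u"] by simp
  then have "fst u \<noteq> 0" by auto
  then obtain J k where J: "is_interval J" "J \<in> sets borel"
    and eq: "\<bar>fst u\<bar> * segment_integral a b (coloring N c) = graph_integral J (snd u / fst u) k (coloring N c)"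
    using segment_integral_eq_graph_integral[of b a N c] unfolding u_def by metis
  have "1 / 2 * \<bar>segment_integral a b (coloring N c)\<bar> \<le> \<bar>fst u\<bar> * \<bar>segment_integral a b (coloring N c)\<bar>"
    using half by (intro mult_right_mono) auto
  also have "\<dots> = \<bar>graph_integral J (snd u / fst u) k (coloring N c)\<bar>"
    unfolding eq[symmetric] by (simp add: abs_mult)
  also have "\<dots> \<le> K"
    using u(1) \<open>fst u \<noteq> 0\<close> by (intro graph J) (simp add: field_simps)
  finally show ?thesis by simp
qed

lemma exists_coloring_small_on_segments:
  assumes N: "N \<ge> 2"
  shows "\<exists>c\<in>signs.
    (\<forall>a b. \<bar>segment_integral a b (coloring N c)\<bar> \<le> 38 * sqrt (real N * ln (real N)))"
proof -
  define s where "s = sqrt (real N * ln (real N))"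
  obtain c where c: "c \<in> signs"
    and net: "\<forall>c'\<in>{c, c \<circ> prod.swap}. \<forall>p q::int. \<forall>i\<le>N. \<forall>j\<le>N. \<bar>p\<bar> \<le> int N ^ 3 \<longrightarrow>
      \<bar>graph_integral {real i..real j} (p / real N ^ 3) (q / real N ^ 3) (coloring N c')\<bar> \<le> 6 * s"
    using exists_coloring_small_on_net[OF N] unfolding s_def by blast
  \<comment> \<open>The additive constants are absorbed because \<open>sqrt (N * ln N)\<close> is at least 1.\<close>
  have "1 / 2 \<le> ln (2 :: real)"
    using ln2_ge_two_thirds by simp
  also have "\<dots> \<le> ln (real N)" using N by simp
  finally have "2 * (1 / 2) \<le> real N * ln (real N)"
    using N by (intro mult_mono) auto
  then have s: "s \<ge> 1" unfolding s_def by simp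
  have graph: "\<bar>graph_integral J m k (coloring N c')\<bar> \<le> 2 * (6 * s) + 7"
    if "c' \<in> {c, c \<circ> prod.swap}" "is_interval J" "J \<in> sets borel" "\<bar>m\<bar> \<le> 1" for c' J m k
  proof (rule graph_integral_le_of_net[OF _ N that(2-4)])
    show "c' \<in> signs" using that(1) c signs_comp[OF c] by blast
  qed (use net that(1) in blast)
  have "\<bar>segment_integral a b (coloring N c)\<bar> \<le> 2 * (2 * (6 * s) + 7)" for a b
  proof (cases "\<bar>snd (b - a)\<bar> \<le> \<bar>fst (b - a)\<bar>")
    case True
    then show ?thesis
      using s graph[of c] by (intro segment_integral_le_of_graphs) auto
  next
    case False
    have "coloring N c = coloring N (c \<circ> prod.swap) \<circ> prod.swap"
      by (rule ext) (simp add: coloring_swap)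
    then have "segment_integral a b (coloring N c)
        = segment_integral (prod.swap a) (prod.swap b) (coloring N (c \<circ> prod.swap))"
      by (simp add: segment_integral_swap)
    also have "\<bar>\<dots>\<bar> \<le> 2 * (2 * (6 * s) + 7)"
      using False s graph[of "c \<circ> prod.swap"] by (intro segment_integral_le_of_graphs) auto
    finally show ?thesis .
  qed
  moreover have "2 * (2 * (6 * s) + 7) \<le> 38 * s" using s by simp
  ultimately show ?thesis
    using c unfolding s_def by (meson order_trans)
qed

theorem theorem3:
  shows "\<exists>C::real. C > 0 \<and>
    (\<forall>N::nat. N \<ge> 2 \<longrightarrow>
      (\<exists>f :: real \<times> real \<Rightarrow> real.
        range f \<subseteq> {0, 1, -1} \<and>
        (\<forall>p. p \<notin> {0..real N} \<times> {0..real N} \<longrightarrow> f p = 0) \<and>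
        (\<forall>i<N. \<forall>j<N. \<exists>c\<in>{1, -1}.
            \<forall>p \<in> {real i..<real i + 1} \<times> {real j..<real j + 1}. f p = c) \<and>
        (\<forall>a b. segment_integrable a b f \<and>
            \<bar>segment_integral a b f\<bar> \<le> C * sqrt (real N * ln (real N)))))"
proof (intro exI[of _ 38] conjI allI impI)
  fix N :: nat assume "N \<ge> 2"
  then obtain c where c: "c \<in> signs"
    and le: "\<And>a b. \<bar>segment_integral a b (coloring N c)\<bar> \<le> 38 * sqrt (real N * ln (real N))"
    using exists_coloring_small_on_segments by blast
  show "\<exists>f :: real \<times> real \<Rightarrow> real.
        range f \<subseteq> {0, 1, -1} \<and>
        (\<forall>p. p \<notin> {0..real N} \<times> {0..real N} \<longrightarrow> f p = 0) \<and>
        (\<forall>i<N. \<forall>j<N. \<exists>c\<in>{1, -1}.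
            \<forall>p \<in> {real i..<real i + 1} \<times> {real j..<real j + 1}. f p = c) \<and>
        (\<forall>a b. segment_integrable a b f \<and>
            \<bar>segment_integral a b f\<bar> \<le> 38 * sqrt (real N * ln (real N)))"
  proof (intro exI[of _ "coloring N c"] conjI allI impI)
    show "range (coloring N c) \<subseteq> {0, 1, -1}"
    proof (rule image_subsetI)
      fix p
      show "coloring N c p \<in> {0, 1, -1}"
        using signs_cases[OF c, of "(nat \<lfloor>fst p\<rfloor>, nat \<lfloor>snd p\<rfloor>)"] coloring_eq[of N c "fst p" "snd p"]
        by (auto split: if_splits)
    qed
    show "coloring N c p = 0" if "p \<notin> {0..real N} \<times> {0..real N}" for p
      using that by (cases p) (auto simp: coloring_eq)
    show "\<exists>e\<in>{1, -1}. \<forall>p\<in>{real i..<real i + 1} \<times> {real j..<real j + 1}. coloring N c p = e"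
      if "i < N" "j < N" for i j
    proof (intro bexI[of _ "c (i, j)"] ballI)
      show "c (i, j) \<in> {1, -1}" using signs_cases[OF c] by simp
    next
      fix p assume p: "p \<in> {real i..<real i + 1} \<times> {real j..<real j + 1}"
      then have "p \<in> cell (i, j)" by (simp add: cell_def)
      then have "(i, j) = (nat \<lfloor>fst p\<rfloor>, nat \<lfloor>snd p\<rfloor>)"
        using mem_cell_iff[of "fst p" "snd p" "(i, j)"] by simp
      moreover have "0 \<le> fst p" "fst p < N" "0 \<le> snd p" "snd p < N"
        using p that by auto
      ultimately show "coloring N c p = c (i, j)"
        using coloring_eq[of N c "fst p" "snd p"] by simp
    qed
    show "segment_integrable a b (coloring N c)" for a b
      by (rule segment_integrable_coloring[OF c])
    show "\<bar>segment_integral a b (coloring N c)\<bar> \<le> 38 * sqrt (real N * ln (real N))" for a b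
      by (rule le)
  qed
qed simp

end
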